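(* If for every realization $f_{T+1}$ of all information over the horizon the critical fractile $\bar y_t=\Phi_t^{-1}\big(\tfrac{p}{p+h}\big)$ is non-decreasing in $t$ (for $t=1,\dots,T$), then the FIFO-optimality assumption (defined in the context) holds.
   Context: Model. A perishable product has a lifetime of $K$ periods; the horizon is $T$ periods; $\beta\in(0,1]$ is a discount factor. Demands $D_1,\dots,D_T\ge 0$ are exogenous random variables with finite means (possibly nonstationary and correlated). At the beginning of period $t$ one observes a realization $f_t$ of $F_t=(D_1,\dots,D_{t-1},U_1,\dots,U_t)$, where the $U_s$ are exogenous forecast information; the conditional joint law of $(D_t,\dots,D_T)$ given $f_t$ is known. The state also contains the inventory vector $\mathbf{x}_t=(x_{1,t},\dots,x_{K-1,t})$, $x_{k,t}\ge0$ being the inventory of age $k$. In period $t$ a quantity $q_t\ge0$ of age-0 product is ordered and arrives immediately; put $x_{0,t}=q_t$ and $y_t=\sum_{k=1}^{K-1}x_{k,t}+q_t$. Then $D_t$ occurs and is served oldest units first (FIFO), unmet demand is lost, all remaining units age by 1 and those reaching age $K$ are discarded (outdated): $X_{k,t+1}=\big(X_{k-1,t}-(D_t-\sum_{m=k}^{K-1}X_{m,t})^+\big)^+$, $k=1,\dots,K-1$, $t=1,\dots,T$. $p,h,w\ge0$ are the unit shortage, holding and outdating costs; there is no ordering cost. Optimal cost-to-go. $C_{T+1}\equiv0$ and $C_t(\mathbf{x}_t,f_t)=\min_{q_t\ge0}\{p\mathrm{E}[(D_t-y_t)^+|f_t]+h\mathrm{E}[(y_t-D_t)^+|f_t]+w\mathrm{E}[(x_{K-1,t}-D_t)^+|f_t]+\beta\mathrm{E}[C_{t+1}(\mathbf{X}_{t+1},F_{t+1})|f_t]\}$.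 "Implementing an optimal ordering policy" in a period means ordering, at the current state, a quantity attaining this minimum. FIFO-optimality assumption. Let $\Phi_t$ be the c.d.f. of $D_t$ conditioned on $f_t$, $\Phi_t^{-1}(z)=\inf\{x:\Phi_t(x)\ge z\}$, and $\bar y_t=\Phi_t^{-1}\big(\tfrac{p}{p+h}\big)$ (determined by $f_t$, which is part of $f_{T+1}$). An issuing policy is a collection of rules $(\mathbf{x}_t,f_t,q_t,d_t)\mapsto(v_{0,t},\dots,v_{K-1,t})$ with $0\le v_{k,t}\le x_{k,t}$ and $\sum_k v_{k,t}=\min\{y_t,d_t\}$ ($v_{k,t}$ units of age $k$ are used to meet demand; then $x_{k+1,t+1}=x_{k,t}-v_{k,t}$ for $0\le k\le K-2$, and $x_{K-1,t}-v_{K-1,t}$ units outdate). FIFO is $v_{k,t}=\min\{x_{k,t},(d_t-\sum_{m=k+1}^{K-1}x_{m,t})^+\}$. The assumption: for every $t$, starting from any state in period $t$ with $y_t\le\max_{\tau=1,\dots,t}\bar y_\tau$, if an optimal ordering policy is implemented in periods $t+1,\dots,T$, then FIFO minimizes the expected total (discounted shortage, holding and outdating) cost over periods $t,\dots,T$ among all issuing policies. *)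

theory Defs
  imports "HOL-Probability.Probability"
begin

text \<open>
  Periods are \<open>1..T\<close>. A stock vector \<open>(x\<^sub>1, \<dots>, x\<^bsub>K-1\<^esub>)\<close> is a function that is extensional on
  \<open>{1..<K}\<close>; adding the order \<open>q\<close> as age-0 stock gives \<open>x(0 := q)\<close>, indexed by \<open>{..<K}\<close>.
  A history \<open>f\<^sub>t\<close> is a pair \<open>((d\<^sub>1, \<dots>, d\<^bsub>t-1\<^esub>), (u\<^sub>1, \<dots>, u\<^sub>t))\<close> of extensional functions.
\<close>

type_synonym stock = "nat \<Rightarrow> real"
type_synonym 'u history = "(nat \<Rightarrow> real) \<times> (nat \<Rightarrow> 'u)"

text \<open>
  \<open>cond_law m t f\<close> is the conditional law of \<open>(D\<^sub>t, U\<^bsub>t+1\<^esub>)\<close> given \<open>F\<^sub>t = f\<close>, that is, of what is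
  added to \<open>f\<close> to form \<open>F\<^bsub>t+1\<^esub>\<close>. Iterating it gives the conditional law of the whole future.
\<close>

record ('w, 'u) perishable =
  prob_space_of :: "'w measure"
  demand :: "nat \<Rightarrow> 'w \<Rightarrow> real"
  signal :: "nat \<Rightarrow> 'w \<Rightarrow> 'u"
  signal_space :: "nat \<Rightarrow> 'u measure"
  cond_law :: "nat \<Rightarrow> 'u history \<Rightarrow> (real \<times> 'u) measure"
  horizon :: nat
  lifetime :: nat
  discount :: real
  shortage_cost :: real
  holding_cost :: real
  outdating_cost :: real

definition history_space :: "('w, 'u) perishable \<Rightarrow> nat \<Rightarrow> 'u history measure" where
  "history_space m t =
     Pi\<^sub>M {1..<t} (\<lambda>_. borel) \<Otimes>\<^sub>M Pi\<^sub>M {1..t} (signal_space m)"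

definition history :: "('w, 'u) perishable \<Rightarrow> nat \<Rightarrow> 'w \<Rightarrow> 'u history" where
  "history m t \<omega> = (\<lambda>s\<in>{1..<t}. demand m s \<omega>, \<lambda>s\<in>{1..t}. signal m s \<omega>)"

definition realizations :: "('w, 'u) perishable \<Rightarrow> nat \<Rightarrow> 'u history set" where
  "realizations m t = history m t ` space (prob_space_of m)"

definition truncate_history :: "nat \<Rightarrow> 'u history \<Rightarrow> 'u history" where
  "truncate_history t f = (restrict (fst f) {1..<t}, restrict (snd f) {1..t})"

definition extend_history :: "nat \<Rightarrow> 'u history \<Rightarrow> real \<times> 'u \<Rightarrow> 'u history" where
  "extend_history t f z = ((fst f)(t := fst z), (snd f)(Suc t := snd z))"

text \<open>
  The assumptions \<open>cond_law_kernel\<close> and \<open>cond_law_version\<close> say that \<open>cond_law\<close> is a regular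
  conditional distribution. This fixes it only up to null sets, whereas costs and fractiles are
  evaluated at every single realization; \<open>cond_law_realizations\<close> makes this meaningful: given a
  realization of \<open>F\<^sub>t\<close>, the next history is almost surely again a realization.
\<close>

locale perishable_inventory =
  fixes m :: "('w, 'u) perishable"
  assumes prob: "prob_space (prob_space_of m)"
    and lifetime_pos: "1 \<le> lifetime m"
    and discount: "0 < discount m" "discount m \<le> 1"
    and unit_costs: "0 \<le> shortage_cost m" "0 \<le> holding_cost m" "0 \<le> outdating_cost m"
    and demand_integrable:
      "\<And>t. t \<in> {1..horizon m} \<Longrightarrow> integrable (prob_space_of m) (demand m t)"
    and demand_nonneg:
      "\<And>t \<omega>. t \<in> {1..horizon m} \<Longrightarrow> \<omega> \<in> space (prob_space_of m) \<Longrightarrow> 0 \<le> demand m t \<omega>"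
    and signal_measurable:
      "\<And>t. t \<in> {1..Suc (horizon m)} \<Longrightarrow>
         signal m t \<in> measurable (prob_space_of m) (signal_space m t)"
    and cond_law_kernel:
      "\<And>t. t \<in> {1..horizon m} \<Longrightarrow>
         cond_law m t \<in> measurable (history_space m t)
           (prob_algebra (borel \<Otimes>\<^sub>M signal_space m (Suc t)))"
    and cond_law_version:
      "\<And>t A B. t \<in> {1..horizon m} \<Longrightarrow> A \<in> sets (history_space m t) \<Longrightarrow>
         B \<in> sets (borel \<Otimes>\<^sub>M signal_space m (Suc t)) \<Longrightarrow>
         emeasure (prob_space_of m)
           {\<omega> \<in> space (prob_space_of m).
              history m t \<omega> \<in> A \<and> (demand m t \<omega>, signal m (Suc t) \<omega>) \<in> B} =
         (\<integral>\<^sup>+\<omega>. indicator A (history m t \<omega>) * emeasure (cond_law m t (history m t \<omega>)) B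
            \<partial>prob_space_of m)"
    and cond_law_realizations:
      "\<And>t f. t \<in> {1..horizon m} \<Longrightarrow> f \<in> realizations m t \<Longrightarrow>
         AE z in cond_law m t f. extend_history t f z \<in> realizations m (Suc t)"

definition stocks :: "('w, 'u) perishable \<Rightarrow> stock set" where
  "stocks m = {1..<lifetime m} \<rightarrow>\<^sub>E {0..}"

definition stock_space :: "('w, 'u) perishable \<Rightarrow> stock measure" where
  "stock_space m = Pi\<^sub>M {1..<lifetime m} (\<lambda>_. borel)"

definition on_hand :: "('w, 'u) perishable \<Rightarrow> stock \<Rightarrow> real \<Rightarrow> real" where
  "on_hand m x q = (\<Sum>k\<in>{1..<lifetime m}. x k) + q"

definition pos :: "real \<Rightarrow> real" where
  "pos r = max r 0"

definition fifo_next :: "('w, 'u) perishable \<Rightarrow> stock \<Rightarrow> real \<Rightarrow> real \<Rightarrow> stock" where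
  "fifo_next m x q d =
     (\<lambda>k\<in>{1..<lifetime m}.
        pos ((x(0 := q)) (k - 1) - pos (d - (\<Sum>j\<in>{k..<lifetime m}. (x(0 := q)) j))))"

text \<open>
  All costs are nonnegative, so expectations are taken in \<^typ>\<open>ennreal\<close>. \<open>bellman m t V x f q\<close> is
  the expected cost of ordering \<open>q\<close> in period \<open>t\<close> under FIFO if \<open>V\<close> is the cost from \<open>t + 1\<close> on.
\<close>

definition bellman ::
  "('w, 'u) perishable \<Rightarrow> nat \<Rightarrow> (stock \<Rightarrow> 'u history \<Rightarrow> ennreal) \<Rightarrow>
   stock \<Rightarrow> 'u history \<Rightarrow> real \<Rightarrow> ennreal" where
  "bellman m t V x f q =
     ennreal (shortage_cost m) * (\<integral>\<^sup>+z. ennreal (pos (fst z - on_hand m x q)) \<partial>cond_law m t f) +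
     ennreal (holding_cost m) * (\<integral>\<^sup>+z. ennreal (pos (on_hand m x q - fst z)) \<partial>cond_law m t f) +
     ennreal (outdating_cost m) *
       (\<integral>\<^sup>+z. ennreal (pos ((x(0 := q)) (lifetime m - 1) - fst z)) \<partial>cond_law m t f) +
     ennreal (discount m) *
       (\<integral>\<^sup>+z. V (fifo_next m x q (fst z)) (extend_history t f z) \<partial>cond_law m t f)"

function cost_to_go ::
  "('w, 'u) perishable \<Rightarrow> nat \<Rightarrow> stock \<Rightarrow> 'u history \<Rightarrow> ennreal" where
  "cost_to_go m t =
     (if horizon m < t then (\<lambda>x f. 0)
      else (\<lambda>x f. INF q\<in>{0..}. bellman m t (cost_to_go m (Suc t)) x f q))"
  by auto
termination
  by (relation "Wellfounded.measure (\<lambda>(m, t). Suc (horizon m) - t)") auto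

declare cost_to_go.simps [simp del]

definition optimal_order ::
  "('w, 'u) perishable \<Rightarrow> nat \<Rightarrow> stock \<Rightarrow> 'u history \<Rightarrow> real \<Rightarrow> bool" where
  "optimal_order m t x f q \<longleftrightarrow>
     0 \<le> q \<and> bellman m t (cost_to_go m (Suc t)) x f q = cost_to_go m t x f"

definition optimal_ordering_policy ::
  "('w, 'u) perishable \<Rightarrow> nat set \<Rightarrow> (nat \<Rightarrow> stock \<Rightarrow> 'u history \<Rightarrow> real) \<Rightarrow> bool" where
  "optimal_ordering_policy m S \<pi> \<longleftrightarrow>
     (\<forall>t\<in>S. (\<lambda>(x, f). \<pi> t x f) \<in> borel_measurable (stock_space m \<Otimes>\<^sub>M history_space m t) \<and>
        (\<forall>x\<in>stocks m. \<forall>f\<in>realizations m t. optimal_order m t x f (\<pi> t x f)))"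

type_synonym 'u issuing = "nat \<Rightarrow> stock \<Rightarrow> 'u history \<Rightarrow> real \<Rightarrow> real \<Rightarrow> nat \<Rightarrow> real"

definition issuing_policy :: "('w, 'u) perishable \<Rightarrow> nat set \<Rightarrow> 'u issuing \<Rightarrow> bool" where
  "issuing_policy m S v \<longleftrightarrow>
     (\<forall>t\<in>S.
        (\<forall>k<lifetime m. (\<lambda>(x, f, q, d). v t x f q d k) \<in>
           borel_measurable (stock_space m \<Otimes>\<^sub>M history_space m t \<Otimes>\<^sub>M borel \<Otimes>\<^sub>M borel)) \<and>
        (\<forall>x\<in>stocks m. \<forall>f\<in>realizations m t. \<forall>q\<ge>0. \<forall>d\<ge>0.
           (\<forall>k<lifetime m. 0 \<le> v t x f q d k \<and> v t x f q d k \<le> (x(0 := q)) k) \<and>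
           (\<Sum>k<lifetime m. v t x f q d k) = min (on_hand m x q) d))"

definition fifo :: "('w, 'u) perishable \<Rightarrow> 'u issuing" where
  "fifo m t x f q d k =
     min ((x(0 := q)) k) (pos (d - (\<Sum>j\<in>{Suc k..<lifetime m}. (x(0 := q)) j)))"

definition issue_next :: "('w, 'u) perishable \<Rightarrow> stock \<Rightarrow> real \<Rightarrow> (nat \<Rightarrow> real) \<Rightarrow> stock" where
  "issue_next m x q u = (\<lambda>k\<in>{1..<lifetime m}. (x(0 := q)) (k - 1) - u (k - 1))"

definition period_cost ::
  "('w, 'u) perishable \<Rightarrow> stock \<Rightarrow> real \<Rightarrow> real \<Rightarrow> (nat \<Rightarrow> real) \<Rightarrow> real" where
  "period_cost m x q d u =
     shortage_cost m * pos (d - on_hand m x q) +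
     holding_cost m * pos (on_hand m x q - d) +
     outdating_cost m * ((x(0 := q)) (lifetime m - 1) - u (lifetime m - 1))"

text \<open>
  Expected total cost over periods \<open>t, \<dots>, T\<close>, discounted to period \<open>t\<close>, when \<open>q\<close> is ordered in
  period \<open>t\<close>, orders follow \<open>\<pi>\<close> from period \<open>t + 1\<close> on, and issuing follows \<open>v\<close> throughout.
\<close>

function total_cost ::
  "('w, 'u) perishable \<Rightarrow> 'u issuing \<Rightarrow> (nat \<Rightarrow> stock \<Rightarrow> 'u history \<Rightarrow> real) \<Rightarrow>
   nat \<Rightarrow> stock \<Rightarrow> 'u history \<Rightarrow> real \<Rightarrow> ennreal" where
  "total_cost m v \<pi> t =
     (if horizon m < t then (\<lambda>x f q. 0)
      else (\<lambda>x f q. \<integral>\<^sup>+z.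
        (let u = v t x f q (fst z);
             x' = issue_next m x q u;
             f' = extend_history t f z
         in ennreal (period_cost m x q (fst z) u) +
            ennreal (discount m) * total_cost m v \<pi> (Suc t) x' f' (\<pi> (Suc t) x' f'))
        \<partial>cond_law m t f))"
  by auto
termination
  by (relation "Wellfounded.measure (\<lambda>(m, v, \<pi>, t). Suc (horizon m) - t)") auto

declare total_cost.simps [simp del]

definition demand_cdf :: "('w, 'u) perishable \<Rightarrow> nat \<Rightarrow> 'u history \<Rightarrow> real \<Rightarrow> real" where
  "demand_cdf m t f x = measure (cond_law m t f) {z \<in> space (cond_law m t f). fst z \<le> x}"

text \<open>
  The infimum is taken in \<^typ>\<open>ereal\<close>: it is \<open>\<infinity>\<close> if the holding cost is 0 and demand is unbounded,
  and \<open>-\<infinity>\<close> if the shortage cost is 0 (also if both costs are 0, where the ratio is read as 0).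
\<close>

definition critical_fractile :: "('w, 'u) perishable \<Rightarrow> nat \<Rightarrow> 'u history \<Rightarrow> ereal" where
  "critical_fractile m t f =
     (INF x\<in>{x. shortage_cost m / (shortage_cost m + holding_cost m) \<le> demand_cdf m t f x}.
        ereal x)"

definition fifo_optimality :: "('w, 'u) perishable \<Rightarrow> bool" where
  "fifo_optimality m \<longleftrightarrow>
     (\<forall>t\<in>{1..horizon m}. \<forall>f\<in>realizations m t. \<forall>x\<in>stocks m. \<forall>q\<ge>0.
        ereal (on_hand m x q)
          \<le> Max ((\<lambda>\<tau>. critical_fractile m \<tau> (truncate_history \<tau> f)) ` {1..t}) \<longrightarrow>
        (\<forall>\<pi>. optimal_ordering_policy m {t<..horizon m} \<pi> \<longrightarrow>
           (\<forall>v. issuing_policy m {t..horizon m} v \<longrightarrow>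
              total_cost m (fifo m) \<pi> t x f q \<le> total_cost m v \<pi> t x f q)))"

end

theory Submission
  imports Defs
begin

text \<open>
  Let \<open>O\<^sub>k(x)\<close> be the stock of age at least \<open>k\<close> in \<open>x\<close>. By backward induction, if the total stock of \<open>x\<close>
  is at most the fractile of period \<open>t\<close>, and \<open>O\<^sub>k(x) \<le> O\<^sub>k(x') + \<psi>\<close> for all \<open>k\<close>, then the optimal
  FIFO cost from \<open>x\<close> exceeds the cost of any ordering and issuing from \<open>x'\<close> by at most \<open>w \<psi>\<close>.
  Indeed, from \<open>x\<close> one can order up to the level reached from \<open>x'\<close>, cut off at the fractile, which
  does not increase the shortage and holding cost of the period. FIFO leaves
  \<open>(O\<^sub>k(x) - d)\<^sup>+\<close> units of age at least \<open>k\<close>, any other issuing rule at least \<open>(O\<^sub>k(x') - d)\<^sup>+\<close>; so if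
  \<open>o\<close> and \<open>o'\<close> units outdate, the new excess is at most \<open>(\<psi> + o' - o)\<^sup>+\<close>, and as the discount factor
  is at most 1 the new penalty is paid for by the old one and the difference in outdating costs.
  The new stock is below the next fractile because fractiles are nondecreasing. The theorem is
  the same one-period comparison with \<open>x = x'\<close> and \<open>\<psi> = 0\<close>.
\<close>

subsection \<open>Integrals of functions that need not be measurable\<close>

text \<open>
  Measurability of the costs-to-go is never established: for an arbitrary integrand the
  integral is a lower integral, which is attained by a measurable minorant.
\<close>

lemma nn_integral_measurable_minorant:
  obtains g where "g \<in> borel_measurable M" "\<And>x. g x \<le> f x" "(\<integral>\<^sup>+x. f x \<partial>M) = (\<integral>\<^sup>+x. g x \<partial>M)"
proof -
  let ?S = "{g. simple_function M g \<and> g \<le> f}"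
  have "(\<lambda>_. 0) \<in> ?S"
    by (auto simp: le_fun_def)
  then have "integral\<^sup>S M ` ?S \<noteq> {}"
    by blast
  \<comment> \<open>The supremum over simple functions is reached along a sequence; the pointwise
    supremum of that sequence is the measurable minorant.\<close>
  from ennreal_Sup_countable_SUP[OF this] obtain I :: "nat \<Rightarrow> ennreal"
    where I: "range I \<subseteq> integral\<^sup>S M ` ?S" "Sup (integral\<^sup>S M ` ?S) = (SUP i. I i)"
    by auto
  then have "\<forall>i. \<exists>g\<in>?S. I i = integral\<^sup>S M g"
    by blast
  then obtain s where s: "\<And>i. s i \<in> ?S" "\<And>i. I i = integral\<^sup>S M (s i)"
    by metis
  let ?g = "\<lambda>x. SUP i. s i x"
  have meas: "?g \<in> borel_measurable M"
    using s(1) by (intro borel_measurable_SUP) (auto intro: borel_measurable_simple_function)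
  have le: "?g x \<le> f x" for x
    using s(1) by (auto intro!: SUP_least simp: le_fun_def)
  have "integral\<^sup>N M f = (SUP i. I i)"
    using I(2) by (simp add: nn_integral_def)
  also have "\<dots> \<le> integral\<^sup>N M ?g"
  proof (rule SUP_least)
    fix i
    have "I i = integral\<^sup>N M (s i)"
      using s by (simp add: nn_integral_eq_simple_integral)
    also have "\<dots> \<le> integral\<^sup>N M ?g"
      by (intro nn_integral_mono) (auto intro: SUP_upper)
    finally show "I i \<le> integral\<^sup>N M ?g" .
  qed
  finally have "integral\<^sup>N M f = integral\<^sup>N M ?g"
    using le by (intro antisym nn_integral_mono[of M ?g f]) auto
  with meas le show thesis
    by (rule that)
qed

text \<open>A lower integral is in general only superadditive. A measurable finite-valued summand
  restores equality: subtracting it from a measurable minorant of the sum leaves a measurable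
  minorant of \<open>g\<close>.\<close>

lemma nn_integral_add_measurable_left:
  fixes f :: "'a \<Rightarrow> real"
  assumes f: "f \<in> borel_measurable M"
  shows "(\<integral>\<^sup>+x. ennreal (f x) + g x \<partial>M) = (\<integral>\<^sup>+x. ennreal (f x) \<partial>M) + (\<integral>\<^sup>+x. g x \<partial>M)"
proof (rule antisym)
  obtain h where h: "h \<in> borel_measurable M" "\<And>x. h x \<le> ennreal (f x) + g x"
    "(\<integral>\<^sup>+x. ennreal (f x) + g x \<partial>M) = (\<integral>\<^sup>+x. h x \<partial>M)"
    by (rule nn_integral_measurable_minorant[of M "\<lambda>x. ennreal (f x) + g x"]) blast
  have "(\<integral>\<^sup>+x. h x \<partial>M) \<le> (\<integral>\<^sup>+x. ennreal (f x) + (h x - ennreal (f x)) \<partial>M)"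
    by (intro nn_integral_mono) (metis add_diff_inverse_ennreal add_increasing2 linear zero_le)
  also have "\<dots> = (\<integral>\<^sup>+x. ennreal (f x) \<partial>M) + (\<integral>\<^sup>+x. h x - ennreal (f x) \<partial>M)"
    using f h by (intro nn_integral_add) auto
  also have "\<dots> \<le> (\<integral>\<^sup>+x. ennreal (f x) \<partial>M) + (\<integral>\<^sup>+x. g x \<partial>M)"
    using h(2) by (intro add_left_mono nn_integral_mono) (simp add: ennreal_minus_le_iff)
  finally show "(\<integral>\<^sup>+x. ennreal (f x) + g x \<partial>M) \<le> (\<integral>\<^sup>+x. ennreal (f x) \<partial>M) + (\<integral>\<^sup>+x. g x \<partial>M)"
    using h(3) by simp
next
  obtain h where h: "h \<in> borel_measurable M" "\<And>x. h x \<le> g x"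
    "(\<integral>\<^sup>+x. g x \<partial>M) = (\<integral>\<^sup>+x. h x \<partial>M)"
    by (rule nn_integral_measurable_minorant[of M g]) blast
  have "(\<integral>\<^sup>+x. ennreal (f x) \<partial>M) + (\<integral>\<^sup>+x. h x \<partial>M) = (\<integral>\<^sup>+x. ennreal (f x) + h x \<partial>M)"
    using f h by (intro nn_integral_add[symmetric]) auto
  also have "\<dots> \<le> (\<integral>\<^sup>+x. ennreal (f x) + g x \<partial>M)"
    using h(2) by (intro nn_integral_mono add_left_mono)
  finally show "(\<integral>\<^sup>+x. ennreal (f x) \<partial>M) + (\<integral>\<^sup>+x. g x \<partial>M) \<le> (\<integral>\<^sup>+x. ennreal (f x) + g x \<partial>M)"
    using h(3) by simp
qed

text \<open>Scaling a minorant gives one inequality for every constant; applying it to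
  \<open>1 / c\<close> gives the reverse one.\<close>

lemma nn_integral_cmult_arbitrary:
  assumes "0 < c"
  shows "(\<integral>\<^sup>+x. ennreal c * g x \<partial>M) = ennreal c * (\<integral>\<^sup>+x. g x \<partial>M)"
proof -
  have ge: "ennreal b * (\<integral>\<^sup>+x. g x \<partial>M) \<le> (\<integral>\<^sup>+x. ennreal b * g x \<partial>M)" for b and g :: "'a \<Rightarrow> ennreal"
  proof -
    obtain h where h: "h \<in> borel_measurable M" "\<And>x. h x \<le> g x"
      "(\<integral>\<^sup>+x. g x \<partial>M) = (\<integral>\<^sup>+x. h x \<partial>M)"
      by (rule nn_integral_measurable_minorant[of M g]) blast
    have "ennreal b * (\<integral>\<^sup>+x. h x \<partial>M) = (\<integral>\<^sup>+x. ennreal b * h x \<partial>M)"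
      using h by (intro nn_integral_cmult[symmetric]) auto
    also have "\<dots> \<le> (\<integral>\<^sup>+x. ennreal b * g x \<partial>M)"
      using h(2) by (intro nn_integral_mono mult_left_mono) auto
    finally show ?thesis
      using h(3) by simp
  qed
  have inv: "ennreal c * ennreal (1 / c) = 1" "ennreal (1 / c) * ennreal c = 1"
    using assms by (simp_all flip: ennreal_mult)
  have "(\<integral>\<^sup>+x. ennreal c * g x \<partial>M) = ennreal c * (ennreal (1 / c) * (\<integral>\<^sup>+x. ennreal c * g x \<partial>M))"
    by (simp add: inv flip: mult.assoc)
  also have "\<dots> \<le> ennreal c * (\<integral>\<^sup>+x. ennreal (1 / c) * (ennreal c * g x) \<partial>M)"
    by (intro mult_left_mono ge) auto
  also have "\<dots> = ennreal c * (\<integral>\<^sup>+x. g x \<partial>M)"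
    by (simp add: inv flip: mult.assoc)
  finally show ?thesis
    using ge[of c g] by (rule antisym)
qed

subsection \<open>Expected shortage and holding cost\<close>

definition newsvendor_loss :: "real \<Rightarrow> real \<Rightarrow> real \<Rightarrow> real \<Rightarrow> real" where
  "newsvendor_loss p h y d = p * pos (d - y) + h * pos (y - d)"

lemma pos_measurable [measurable]: "pos \<in> borel_measurable borel"
  unfolding pos_def by measurable

lemma newsvendor_loss_measurable [measurable]: "newsvendor_loss p h y \<in> borel_measurable borel"
  unfolding newsvendor_loss_def by measurable

lemma pos_nonneg [simp]: "0 \<le> pos r"
  by (simp add: pos_def)

lemma newsvendor_loss_nonneg: "0 \<le> p \<Longrightarrow> 0 \<le> h \<Longrightarrow> 0 \<le> newsvendor_loss p h y d"
  by (simp add: newsvendor_loss_def)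

text \<open>Makes the loss at \<open>y\<close> integrable whenever the loss at \<open>y'\<close> is,
  because constants are integrable over a probability measure.\<close>

lemma newsvendor_loss_lipschitz:
  assumes "0 \<le> p" "0 \<le> h"
  shows "newsvendor_loss p h y d \<le> newsvendor_loss p h y' d + (p + h) * \<bar>y - y'\<bar>"
proof -
  have "p * pos (d - y) \<le> p * (pos (d - y') + \<bar>y - y'\<bar>)"
    "h * pos (y - d) \<le> h * (pos (y' - d) + \<bar>y - y'\<bar>)"
    using assms by (intro mult_left_mono; simp add: pos_def)+
  then show ?thesis
    by (simp add: newsvendor_loss_def algebra_simps)
qed

text \<open>The loss is convex in \<open>y\<close>, with slope \<open>h\<close> where
  \<open>d < y\<close> and \<open>-p\<close> where \<open>d > y\<close>. The set \<open>A\<close>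
  decides the kink \<open>d = y\<close>: \<open>{..<y}\<close> yields the left derivative,
  \<open>{..y}\<close> the right one.\<close>

lemma newsvendor_loss_subgradient:
  assumes "0 \<le> p" "0 \<le> h" "{..<y} \<subseteq> A" "A \<subseteq> {..y}"
  shows "newsvendor_loss p h y d + (y' - y) * ((p + h) * indicator A d - p) \<le> newsvendor_loss p h y' d"
proof -
  have A: "d \<in> A \<Longrightarrow> d \<le> y" "d \<notin> A \<Longrightarrow> y \<le> d"
    using assms by force+
  show ?thesis
  proof (cases "d \<in> A")
    case True
    have "h * (y' - d) \<le> p * pos (d - y') + h * pos (y' - d)"
      using assms by (intro add_increasing mult_left_mono) (auto simp: pos_def)
    with True A show ?thesis
      by (simp add: newsvendor_loss_def pos_def algebra_simps)
  next
    case False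
    have "p * (d - y') \<le> p * pos (d - y') + h * pos (y' - d)"
      using assms by (intro add_increasing2 mult_left_mono) (auto simp: pos_def)
    with False A show ?thesis
      by (simp add: newsvendor_loss_def pos_def algebra_simps)
  qed
qed

text \<open>Integrating the subgradient inequality turns the slope into
  \<open>(p + h) * prob A - p\<close>. If the loss at \<open>y'\<close> has infinite expectation,
  the claim is trivial.\<close>

lemma (in real_distribution) expected_newsvendor_loss_mono:
  assumes ph: "0 \<le> p" "0 \<le> h" and A: "{..<y} \<subseteq> A" "A \<subseteq> {..y}" "A \<in> sets borel"
    and slope: "0 \<le> (y' - y) * ((p + h) * prob A - p)"
  shows "(\<integral>\<^sup>+d. ennreal (newsvendor_loss p h y d) \<partial>M) \<le> (\<integral>\<^sup>+d. ennreal (newsvendor_loss p h y' d) \<partial>M)"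
proof (cases "(\<integral>\<^sup>+d. ennreal (newsvendor_loss p h y' d) \<partial>M) = \<infinity>")
  case False
  let ?L = "newsvendor_loss p h"
  note nonneg = newsvendor_loss_nonneg[OF ph]
  have int': "integrable M (?L y')"
    using False nonneg by (intro integrableI_nonneg) (auto simp: less_top)
  have int: "integrable M (?L y)"
  proof (rule Bochner_Integration.integrable_bound)
    show "integrable M (\<lambda>d. ?L y' d + (p + h) * \<bar>y - y'\<bar>)"
      using int' by simp
    have "norm (?L y d) \<le> norm (?L y' d + (p + h) * \<bar>y - y'\<bar>)" for d
      using nonneg[of y d] newsvendor_loss_lipschitz[OF ph, of y d y'] by simp
    then show "AE d in M. norm (?L y d) \<le> norm (?L y' d + (p + h) * \<bar>y - y'\<bar>)"
      by simp
  qed simp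
  have intA: "integrable M (indicator A :: real \<Rightarrow> real)"
    using A by (intro integrable_real_indicator) (auto simp: less_top[symmetric])
  have "expectation (?L y) + (y' - y) * ((p + h) * prob A - p)
      = expectation (\<lambda>d. ?L y d + (y' - y) * ((p + h) * indicator A d - p))"
    using int intA A prob_space by simp
  also have "\<dots> \<le> expectation (?L y')"
    using int int' intA newsvendor_loss_subgradient[OF ph A(1,2)]
    by (intro integral_mono) auto
  finally have "expectation (?L y) \<le> expectation (?L y')"
    using slope by linarith
  then show ?thesis
    using int int' nonneg by (simp add: nn_integral_eq_integral ennreal_leI)
qed simp

text \<open>Left of \<open>y\<close> the cdf stays at or below the critical ratio, hence so does its
  left limit \<open>prob {..<y}\<close>. The left derivative of the expected loss is then
  nonpositive, and by convexity going down from \<open>y\<close> does not help.\<close>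

lemma (in real_distribution) expected_newsvendor_loss_below_fractile:
  assumes p: "0 \<le> p" "0 \<le> h" "0 < p + h"
    and y: "ereal y \<le> (INF x\<in>{x. p / (p + h) \<le> cdf M x}. ereal x)"
    and "y' \<le> y"
  shows "(\<integral>\<^sup>+d. ennreal (newsvendor_loss p h y d) \<partial>M) \<le> (\<integral>\<^sup>+d. ennreal (newsvendor_loss p h y' d) \<partial>M)"
proof (rule expected_newsvendor_loss_mono[OF p(1,2), where A = "{..<y}"])
  have "cdf M r \<le> p / (p + h)" if "r < y" for r
  proof (rule ccontr)
    assume "\<not> cdf M r \<le> p / (p + h)"
    then have "(INF x\<in>{x. p / (p + h) \<le> cdf M x}. ereal x) \<le> ereal r"
      by (intro INF_lower) auto
    with y that show False
      by (metis ereal_less_eq(3) not_le order_trans)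
  qed
  then have "prob {..<y} \<le> p / (p + h)"
    by (intro tendsto_upperbound[OF cdf_at_left]) (auto simp: eventually_at_filter)
  then have "(p + h) * prob {..<y} - p \<le> 0"
    using p by (simp add: field_simps)
  then show "0 \<le> (y' - y) * ((p + h) * prob {..<y} - p)"
    using \<open>y' \<le> y\<close> by (simp add: mult_nonpos_nonpos)
qed auto

text \<open>Here the right derivative is used: right-continuity carries the critical ratio over to
  the cdf at the fractile itself, so going up does not help.\<close>

lemma (in real_distribution) expected_newsvendor_loss_above_fractile:
  assumes p: "0 \<le> p" "0 \<le> h" "0 < p + h"
    and y: "ereal y = (INF x\<in>{x. p / (p + h) \<le> cdf M x}. ereal x)"
    and "y \<le> y'"
  shows "(\<integral>\<^sup>+d. ennreal (newsvendor_loss p h y d) \<partial>M) \<le> (\<integral>\<^sup>+d. ennreal (newsvendor_loss p h y' d) \<partial>M)"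
proof (rule expected_newsvendor_loss_mono[OF p(1,2), where A = "{..y}"])
  have "p / (p + h) \<le> cdf M r" if "y < r" for r
  proof -
    have "(INF x\<in>{x. p / (p + h) \<le> cdf M x}. ereal x) < ereal r"
      using that by (simp flip: y)
    then obtain x where "p / (p + h) \<le> cdf M x" "x < r"
      by (auto simp: INF_less_iff)
    then show ?thesis
      using cdf_nondecreasing[of x r] by simp
  qed
  moreover have "(cdf M \<longlongrightarrow> cdf M y) (at_right y)"
    using cdf_is_right_cont[of y] by (simp add: continuous_within)
  ultimately have "p / (p + h) \<le> cdf M y"
    by (intro tendsto_lowerbound[of "cdf M" "cdf M y" "at_right y"]) (auto simp: eventually_at_filter)
  then have "0 \<le> (p + h) * prob {..y} - p"
    using p by (simp add: field_simps cdf_def2)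
  then show "0 \<le> (y' - y) * ((p + h) * prob {..y} - p)"
    using \<open>y \<le> y'\<close> by simp
qed auto

subsection \<open>Stock by age and histories\<close>

text \<open>The quantity \<open>O\<^sub>k\<close> of the overview. A stock vector carries no
  meaningful value at age 0, so index 0 is meant for vectors to which the order has been
  added.\<close>

definition aged :: "('w, 'u) perishable \<Rightarrow> stock \<Rightarrow> nat \<Rightarrow> real" where
  "aged m z k = (\<Sum>j\<in>{k..<lifetime m}. z j)"

lemma aged_Suc: "k < lifetime m \<Longrightarrow> aged m z k = z k + aged m z (Suc k)"
  by (simp add: aged_def sum.atLeast_Suc_lessThan)

lemma aged_beyond: "lifetime m \<le> k \<Longrightarrow> aged m z k = 0"
  by (simp add: aged_def)

lemma aged_upd: "1 \<le> k \<Longrightarrow> aged m (x(0 := q)) k = aged m x k"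
  by (auto simp: aged_def intro!: sum.cong)

text \<open>Aging shifts indices by one. With \<open>g j\<close> the amount of age at least
  \<open>j\<close> left after demand, the new stock consists of differences of \<open>g\<close>, and
  the subtracted end term is what outdates. This serves FIFO and arbitrary issuing alike.\<close>

lemma aged_telescope:
  assumes "1 \<le> k" "k \<le> lifetime m" "\<And>j. 1 \<le> j \<Longrightarrow> j < lifetime m \<Longrightarrow> x j = g (j - 1) - g j"
  shows "aged m x k = g (k - 1) - g (lifetime m - 1)"
  using assms(2,1)
proof (induction k rule: inc_induct)
  case base
  then show ?case
    by (simp add: aged_beyond)
next
  case (step n)
  then show ?case
    using assms(3)[of n] by (simp add: aged_Suc)
qed

lemma stock_upd_nonneg: "x \<in> stocks m \<Longrightarrow> 0 \<le> q \<Longrightarrow> k < lifetime m \<Longrightarrow> 0 \<le> (x(0 := q)) k"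
  by (auto simp: stocks_def PiE_iff)

lemma aged_nonneg: "x \<in> stocks m \<Longrightarrow> 1 \<le> k \<Longrightarrow> 0 \<le> aged m x k"
  by (auto simp: aged_def stocks_def PiE_iff intro!: sum_nonneg)

lemma fifo_next_stocks: "fifo_next m x q d \<in> stocks m"
  by (auto simp: fifo_next_def stocks_def)

text \<open>Serving the oldest units first leaves \<open>pos (O\<^sub>k - d)\<close> units of age at
  least \<open>k\<close>; each new age class is a difference of two such amounts.\<close>

lemma fifo_next_eq:
  assumes "x \<in> stocks m" "0 \<le> q" "1 \<le> k" "k < lifetime m"
  shows "fifo_next m x q d k = pos (aged m (x(0 := q)) (k - 1) - d) - pos (aged m (x(0 := q)) k - d)"
proof -
  have "aged m (x(0 := q)) (k - 1) = (x(0 := q)) (k - 1) + aged m (x(0 := q)) k"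
    using assms aged_Suc[of "k - 1" m "x(0 := q)"] by simp
  moreover have "0 \<le> (x(0 := q)) (k - 1)"
    using assms by (intro stock_upd_nonneg) auto
  moreover have "fifo_next m x q d k = pos ((x(0 := q)) (k - 1) - pos (d - aged m (x(0 := q)) k))"
    using assms by (simp add: fifo_next_def aged_def)
  ultimately show ?thesis
    unfolding pos_def by (smt (verit))
qed

lemma aged_fifo_next:
  assumes "x \<in> stocks m" "0 \<le> q" "1 \<le> k" "k \<le> lifetime m"
  shows "aged m (fifo_next m x q d) k =
    pos (aged m (x(0 := q)) (k - 1) - d) - pos (aged m (x(0 := q)) (lifetime m - 1) - d)"
  using assms by (intro aged_telescope fifo_next_eq) auto

lemma aged_issue_next:
  assumes "1 \<le> k" "k \<le> lifetime m"
  shows "aged m (issue_next m x q u) k =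
    aged m (\<lambda>j. (x(0 := q)) j - u j) (k - 1) - ((x(0 := q)) (lifetime m - 1) - u (lifetime m - 1))"
proof -
  define r where "r = (\<lambda>j. (x(0 := q)) j - u j)"
  have "aged m (issue_next m x q u) k = aged m r (k - 1) - aged m r (lifetime m - 1)"
  proof (rule aged_telescope[OF assms])
    fix j assume "1 \<le> j" "j < lifetime m"
    then show "issue_next m x q u j = aged m r (j - 1) - aged m r j"
      using aged_Suc[of "j - 1" m r] by (simp add: issue_next_def r_def)
  qed
  moreover have "aged m r (lifetime m - 1) = r (lifetime m - 1)"
    using assms by (subst aged_Suc) (auto simp: aged_beyond)
  ultimately show ?thesis
    by (simp add: r_def)
qed

lemma fifo_eq_aged: "fifo m t x f q d k = min ((x(0 := q)) k) (pos (d - aged m (x(0 := q)) (Suc k)))"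
  by (simp add: fifo_def aged_def)

lemma issue_next_fifo: "issue_next m x q (fifo m t x f q d) = fifo_next m x q d"
  by (auto simp: issue_next_def fifo_next_def fifo_def pos_def min_def max_def fun_eq_iff restrict_def)

lemma truncate_history_history:
  "t \<le> s \<Longrightarrow> truncate_history t (history m s \<omega>) = history m t \<omega>"
  by (auto simp: truncate_history_def history_def restrict_def fun_eq_iff)

lemma truncate_extend_history:
  "s \<le> t \<Longrightarrow> truncate_history s (extend_history t f z) = truncate_history s f"
  by (auto simp: truncate_history_def extend_history_def restrict_def fun_eq_iff)

lemma truncate_realization: "f \<in> realizations m t \<Longrightarrow> truncate_history t f = f"
  by (auto simp: realizations_def truncate_history_history)

section \<open>Conditional laws at realizations and decomposition of the costs\<close>

abbreviation expected_loss :: "('w, 'u) perishable \<Rightarrow> nat \<Rightarrow> 'u history \<Rightarrow> real \<Rightarrow> ennreal" where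
  "expected_loss m t f y \<equiv>
     \<integral>\<^sup>+z. ennreal (newsvendor_loss (shortage_cost m) (holding_cost m) y (fst z)) \<partial>cond_law m t f"

lemma cost_to_go_beyond_horizon: "horizon m < t \<Longrightarrow> cost_to_go m t x f = 0"
  by (simp add: cost_to_go.simps)

lemma cost_to_go_le_bellman:
  "t \<le> horizon m \<Longrightarrow> 0 \<le> q \<Longrightarrow> cost_to_go m t x f \<le> bellman m t (cost_to_go m (Suc t)) x f q"
  unfolding cost_to_go.simps[of m t] by (auto intro: INF_lower)

lemma total_cost_beyond_horizon: "horizon m < t \<Longrightarrow> total_cost m v \<pi> t x f q = 0"
  by (simp add: total_cost.simps)

context perishable_inventory
begin

lemma on_hand_eq_aged: "on_hand m x q = aged m (x(0 := q)) 0"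
  using lifetime_pos aged_Suc[of 0 m "x(0 := q)"] aged_upd[of "Suc 0" m x q]
  by (simp add: on_hand_def aged_def)

lemma on_hand_eq: "on_hand m x q = aged m x 1 + q"
  by (simp add: on_hand_def aged_def)

lemma oldest_eq_aged: "(x(0 := q)) (lifetime m - 1) = aged m (x(0 := q)) (lifetime m - 1)"
  using lifetime_pos by (subst aged_Suc) (auto simp: aged_beyond)

text \<open>The kernel assumption speaks only about points of the history space; this makes it
  applicable at each realization.\<close>

lemma realization_in_history_space:
  assumes "t \<in> {1..horizon m}" "f \<in> realizations m t"
  shows "f \<in> space (history_space m t)"
  using assms measurable_space[OF signal_measurable]
  by (fastforce simp: realizations_def history_def history_space_def space_pair_measure space_PiM)

lemma
  assumes "t \<in> {1..horizon m}" "f \<in> realizations m t"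
  shows prob_space_cond_law: "prob_space (cond_law m t f)"
    and sets_cond_law: "sets (cond_law m t f) = sets (borel \<Otimes>\<^sub>M signal_space m (Suc t))"
  using measurable_space[OF cond_law_kernel realization_in_history_space, OF assms(1) assms]
  by (auto simp: space_prob_algebra)

lemma fst_measurable_cond_law:
  assumes "t \<in> {1..horizon m}" "f \<in> realizations m t"
  shows "fst \<in> borel_measurable (cond_law m t f)"
  using measurable_fst by (subst measurable_cong_sets[OF sets_cond_law[OF assms] refl])

text \<open>Nonnegativity of demand is assumed on sample points, not under \<open>cond_law\<close>.
  It transfers because an extended history that is a realization has \<open>fst z\<close> as its
  demand at some sample point.\<close>

lemma AE_extend_history:
  assumes "t \<in> {1..horizon m}" "f \<in> realizations m t"
  shows "AE z in cond_law m t f. 0 \<le> fst z \<and> extend_history t f z \<in> realizations m (Suc t)"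
  using cond_law_realizations[OF assms]
proof eventually_elim
  case (elim z)
  then obtain \<omega> where "\<omega> \<in> space (prob_space_of m)" "extend_history t f z = history m (Suc t) \<omega>"
    by (auto simp: realizations_def)
  moreover from this(2) have "fst (extend_history t f z) t = fst (history m (Suc t) \<omega>) t"
    by simp
  then have "fst z = demand m t \<omega>"
    using assms by (simp add: extend_history_def history_def)
  ultimately show ?case
    using elim demand_nonneg assms by auto
qed

lemma demand_cdf_eq_cdf:
  assumes "t \<in> {1..horizon m}" "f \<in> realizations m t"
  shows "demand_cdf m t f = cdf (distr (cond_law m t f) borel fst)"
  using fst_measurable_cond_law[OF assms]
  by (auto simp: demand_cdf_def cdf_def measure_distr fun_eq_iff intro!: arg_cong[where f = "measure _"])

lemma expected_loss_eq_distr: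
  assumes "t \<in> {1..horizon m}" "f \<in> realizations m t"
  shows "expected_loss m t f y = (\<integral>\<^sup>+d. ennreal (newsvendor_loss (shortage_cost m) (holding_cost m) y d)
    \<partial>distr (cond_law m t f) borel fst)"
  using fst_measurable_cond_law[OF assms] by (simp add: nn_integral_distr)

text \<open>With zero shortage cost the critical ratio is 0 (also for \<open>0 / 0\<close>), every
  real level satisfies the cdf condition, and the fractile is \<open>-\<infinity>\<close>.\<close>

lemma shortage_cost_pos_of_fractile:
  assumes "ereal y \<le> critical_fractile m t f"
  shows "0 < shortage_cost m"
proof (rule ccontr)
  assume "\<not> 0 < shortage_cost m"
  then have "shortage_cost m = 0"
    using unit_costs(1) by simp
  then have "critical_fractile m t f \<le> ereal (y - 1)"
    unfolding critical_fractile_def by (intro INF_lower) (simp add: demand_cdf_def)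
  with assms have "ereal y \<le> ereal (y - 1)"
    by (rule order_trans)
  then show False
    by simp
qed

text \<open>The level is \<open>max a y'\<close> if \<open>y'\<close> is at most the fractile, and
  otherwise the fractile itself. The alternative \<open>y = a \<or> y \<le> y'\<close> later bounds
  the excess in total stock.\<close>

lemma order_up_to_level:
  assumes t: "t \<in> {1..horizon m}" "f \<in> realizations m t"
    and a: "ereal a \<le> critical_fractile m t f"
  obtains y where "a \<le> y" "y = a \<or> y \<le> y'" "ereal y \<le> critical_fractile m t f"
    "expected_loss m t f y \<le> expected_loss m t f y'"
proof -
  let ?p = "shortage_cost m" and ?h = "holding_cost m"
  interpret prob_space "cond_law m t f"
    by (rule prob_space_cond_law[OF t])
  interpret D: real_distribution "distr (cond_law m t f) borel fst"
    using fst_measurable_cond_law[OF t] by simp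
  have ph: "0 \<le> ?p" "0 \<le> ?h" "0 < ?p + ?h"
    using unit_costs shortage_cost_pos_of_fractile[OF a] by auto
  note fractile = critical_fractile_def[of m t f, unfolded demand_cdf_eq_cdf[OF t]]
  show thesis
  proof (cases "ereal y' \<le> critical_fractile m t f")
    case True
    show thesis
    proof (rule that[of "max a y'"])
      show "ereal (max a y') \<le> critical_fractile m t f"
        using True a by (simp add: max_def)
      then show "expected_loss m t f (max a y') \<le> expected_loss m t f y'"
        unfolding expected_loss_eq_distr[OF t] fractile
        by (intro D.expected_newsvendor_loss_below_fractile[OF ph]) auto
    qed auto
  next
    case False
    \<comment> \<open>The fractile lies between \<open>a\<close> and \<open>y'\<close>, so it is a
      real number.\<close>
    with a obtain y where y: "critical_fractile m t f = ereal y"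
      by (cases "critical_fractile m t f") auto
    have "expected_loss m t f y \<le> expected_loss m t f y'"
      unfolding expected_loss_eq_distr[OF t]
      using False y by (intro D.expected_newsvendor_loss_above_fractile[OF ph]) (auto simp: fractile)
    with False a y show thesis
      by (intro that[of y]) auto
  qed
qed

text \<open>Only the newsvendor terms are split off; outdating and continuation stay under one
  integral, since they are compared pointwise in \<open>z\<close>.\<close>

lemma bellman_eq:
  assumes t: "t \<in> {1..horizon m}" "f \<in> realizations m t"
  shows "bellman m t V x f q = expected_loss m t f (on_hand m x q) +
    (\<integral>\<^sup>+z. ennreal (outdating_cost m * pos ((x(0 := q)) (lifetime m - 1) - fst z)) +
      ennreal (discount m) * V (fifo_next m x q (fst z)) (extend_history t f z) \<partial>cond_law m t f)"
proof -
  note [measurable] = fst_measurable_cond_law[OF t]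
  let ?M = "cond_law m t f"
  have "expected_loss m t f (on_hand m x q) =
      ennreal (shortage_cost m) * (\<integral>\<^sup>+z. ennreal (pos (fst z - on_hand m x q)) \<partial>?M) +
      ennreal (holding_cost m) * (\<integral>\<^sup>+z. ennreal (pos (on_hand m x q - fst z)) \<partial>?M)"
    using unit_costs unfolding newsvendor_loss_def
    by (simp add: ennreal_plus ennreal_mult nn_integral_add nn_integral_cmult)
  moreover have "(\<integral>\<^sup>+z. ennreal (outdating_cost m * pos ((x(0 := q)) (lifetime m - 1) - fst z)) +
      ennreal (discount m) * V (fifo_next m x q (fst z)) (extend_history t f z) \<partial>?M) =
      ennreal (outdating_cost m) * (\<integral>\<^sup>+z. ennreal (pos ((x(0 := q)) (lifetime m - 1) - fst z)) \<partial>?M) +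
      ennreal (discount m) * (\<integral>\<^sup>+z. V (fifo_next m x q (fst z)) (extend_history t f z) \<partial>?M)"
    using unit_costs discount
    by (subst nn_integral_add_measurable_left)
      (simp_all add: ennreal_mult nn_integral_cmult nn_integral_cmult_arbitrary)
  ultimately show ?thesis
    by (simp add: bellman_def add.assoc)
qed

text \<open>The counterpart of \<open>bellman_eq\<close> for arbitrary issuing. The bound on the
  oldest age keeps the outdating term nonnegative, so \<open>ennreal\<close> does not truncate it;
  \<open>0 \<le> d\<close> suffices there, as negative demand has probability zero.\<close>

lemma total_cost_eq:
  assumes t: "t \<in> {1..horizon m}" "f \<in> realizations m t" and x: "x \<in> stocks m" "0 \<le> q"
    and u: "\<And>d. 0 \<le> d \<Longrightarrow> v t x f q d (lifetime m - 1) \<le> (x(0 := q)) (lifetime m - 1)"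
  shows "total_cost m v \<pi> t x f q = expected_loss m t f (on_hand m x q) +
    (\<integral>\<^sup>+z. (let u = v t x f q (fst z); x' = issue_next m x q u; f' = extend_history t f z
      in ennreal (outdating_cost m * ((x(0 := q)) (lifetime m - 1) - u (lifetime m - 1))) +
        ennreal (discount m) * total_cost m v \<pi> (Suc t) x' f' (\<pi> (Suc t) x' f')) \<partial>cond_law m t f)"
    (is "_ = _ + (\<integral>\<^sup>+z. ?g z \<partial>_)")
proof -
  note [measurable] = fst_measurable_cond_law[OF t]
  let ?L = "newsvendor_loss (shortage_cost m) (holding_cost m)"
  have not_beyond: "\<not> horizon m < t"
    using t by simp
  have "total_cost m v \<pi> t x f q =
      (\<integral>\<^sup>+z. ennreal (?L (on_hand m x q) (fst z)) + ?g z \<partial>cond_law m t f)"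
    unfolding total_cost.simps[of m v \<pi> t] if_not_P[OF not_beyond]
  proof (intro nn_integral_cong_AE, use AE_extend_history[OF t] in eventually_elim)
    case (elim z)
    let ?o = "outdating_cost m * ((x(0 := q)) (lifetime m - 1) - v t x f q (fst z) (lifetime m - 1))"
    have "0 \<le> ?o"
      using elim u[of "fst z"] unit_costs by simp
    moreover have "period_cost m x q (fst z) (v t x f q (fst z)) = ?L (on_hand m x q) (fst z) + ?o"
      by (simp add: period_cost_def newsvendor_loss_def)
    ultimately show ?case
      unfolding Let_def
      by (simp only: ennreal_plus[OF newsvendor_loss_nonneg[OF unit_costs(1,2)]] add.assoc)
  qed
  also have "\<dots> = expected_loss m t f (on_hand m x q) + (\<integral>\<^sup>+z. ?g z \<partial>cond_law m t f)"
    by (intro nn_integral_add_measurable_left) simp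
  finally show ?thesis .
qed

text \<open>By backward induction: the next order attains the minimum, so the bound for the next
  period becomes its cost-to-go. This is where optimality of \<open>\<pi>\<close> enters; the
  comparison below takes from it only that orders are nonnegative.\<close>

lemma total_cost_fifo_le_bellman:
  assumes \<pi>: "optimal_ordering_policy m {t<..horizon m} \<pi>"
    and t: "t \<in> {1..horizon m}" and "f \<in> realizations m t" "x \<in> stocks m" "0 \<le> q"
  shows "total_cost m (fifo m) \<pi> t x f q \<le> bellman m t (cost_to_go m (Suc t)) x f q"
proof -
  have "s \<le> horizon m \<Longrightarrow> f \<in> realizations m s \<Longrightarrow> x \<in> stocks m \<Longrightarrow> 0 \<le> q \<Longrightarrow>
      total_cost m (fifo m) \<pi> s x f q \<le> bellman m s (cost_to_go m (Suc s)) x f q"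
    if "t \<le> s" "s \<le> Suc (horizon m)" for s f x q
    using that(2,1)
  proof (induction s arbitrary: f x q rule: inc_induct)
    case (step s)
    have s: "s \<in> {1..horizon m}"
      using step.prems t by auto
    have next_le: "total_cost m (fifo m) \<pi> (Suc s) X f' (\<pi> (Suc s) X f') \<le> cost_to_go m (Suc s) X f'"
      if "X \<in> stocks m" "f' \<in> realizations m (Suc s)" for X f'
    proof (cases "Suc s \<le> horizon m")
      case True
      with \<pi> step.prems that have "optimal_order m (Suc s) X f' (\<pi> (Suc s) X f')"
        by (auto simp: optimal_ordering_policy_def)
      then have "0 \<le> \<pi> (Suc s) X f'" "bellman m (Suc s) (cost_to_go m (Suc (Suc s))) X f' (\<pi> (Suc s) X f')
          = cost_to_go m (Suc s) X f'"
        by (simp_all add: optimal_order_def)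
      then show ?thesis
        using step.IH[OF True that(2,1), of "\<pi> (Suc s) X f'"] step.prems by simp
    qed (simp add: total_cost_beyond_horizon)
    \<comment> \<open>No stock is older than age \<open>lifetime m - 1\<close>, so FIFO serves it
      first. For lifetime 1 this is age 0, the order itself.\<close>
    have oldest: "(x(0 := q)) (lifetime m - 1) - fifo m s x f q d (lifetime m - 1)
        = pos ((x(0 := q)) (lifetime m - 1) - d)" if "0 \<le> d" for d
      using that lifetime_pos unfolding fifo_eq_aged
      by (simp add: aged_beyond pos_def min_def max_def del: fun_upd_apply)
    have "total_cost m (fifo m) \<pi> s x f q = expected_loss m s f (on_hand m x q) +
      (\<integral>\<^sup>+z. (let u = fifo m s x f q (fst z); x' = issue_next m x q u; f' = extend_history s f z
        in ennreal (outdating_cost m * ((x(0 := q)) (lifetime m - 1) - u (lifetime m - 1))) +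
          ennreal (discount m) * total_cost m (fifo m) \<pi> (Suc s) x' f' (\<pi> (Suc s) x' f')) \<partial>cond_law m s f)"
      using s step.prems by (intro total_cost_eq) (auto simp: fifo_def)
    also have "\<dots> \<le> bellman m s (cost_to_go m (Suc s)) x f q"
      unfolding bellman_eq[OF s step.prems(2)]
    proof (intro add_left_mono nn_integral_mono_AE, use AE_extend_history[OF s step.prems(2)] in eventually_elim)
      case (elim z)
      then show ?case
        using oldest[of "fst z"] next_le[OF fifo_next_stocks[of m x q "fst z"] conjunct2[OF elim]]
        by (simp add: Let_def issue_next_fifo add_left_mono mult_left_mono del: fun_upd_apply)
    qed
    finally show ?case .
  qed simp
  then show ?thesis
    using assms by auto
qed

text \<open>Issuing removes at most \<open>d\<close> units altogether, hence at most
  \<open>d\<close> of age at least \<open>k\<close>.\<close>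

lemma aged_after_issuing:
  assumes x: "x \<in> stocks m" "0 \<le> q"
    and u: "\<And>k. k < lifetime m \<Longrightarrow> 0 \<le> u k \<and> u k \<le> (x(0 := q)) k"
      "(\<Sum>k<lifetime m. u k) = min (on_hand m x q) d"
  shows "pos (aged m (x(0 := q)) k - d) \<le> aged m (\<lambda>j. (x(0 := q)) j - u j) k"
proof -
  have "(\<Sum>j\<in>{k..<lifetime m}. u j) \<le> (\<Sum>j<lifetime m. u j)"
    using u(1) by (intro sum_mono2) auto
  then have "aged m (x(0 := q)) k - d \<le> aged m (\<lambda>j. (x(0 := q)) j - u j) k"
    using u(2) by (simp add: aged_def sum_subtractf)
  moreover have "0 \<le> aged m (\<lambda>j. (x(0 := q)) j - u j) k"
    using u(1) unfolding aged_def by (intro sum_nonneg) (simp del: fun_upd_apply)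
  ultimately show ?thesis
    by (simp add: pos_def)
qed

lemma issue_next_stocks:
  assumes "\<And>k. k < lifetime m \<Longrightarrow> u k \<le> (x(0 := q)) k"
  shows "issue_next m x q u \<in> stocks m"
  using assms by (auto simp: issue_next_def stocks_def simp del: fun_upd_apply)

end

subsection \<open>Comparison with arbitrary ordering and issuing\<close>

locale nondecreasing_fractiles = perishable_inventory +
  assumes fractile_mono: "\<And>f. f \<in> realizations m (Suc (horizon m)) \<Longrightarrow>
    mono_on {1..horizon m} (\<lambda>t. critical_fractile m t (truncate_history t f))"
begin

text \<open>The monotonicity hypothesis speaks of complete histories; a sample point producing
  \<open>f\<close> also produces a complete one that truncates to \<open>f\<close>.\<close>

lemma fractile_le:
  assumes "f \<in> realizations m s" "1 \<le> \<tau>" "\<tau> \<le> t" "t \<le> s" "s \<le> horizon m"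
  shows "critical_fractile m \<tau> (truncate_history \<tau> f) \<le> critical_fractile m t (truncate_history t f)"
proof -
  obtain \<omega> where \<omega>: "\<omega> \<in> space (prob_space_of m)" "f = history m s \<omega>"
    using assms by (auto simp: realizations_def)
  then show ?thesis
    using mono_onD[OF fractile_mono[of "history m (Suc (horizon m)) \<omega>"], of \<tau> t] assms
    by (simp add: realizations_def truncate_history_history)
qed

lemma fractile_extend_le:
  assumes "f \<in> realizations m t" "extend_history t f z \<in> realizations m (Suc t)" "1 \<le> t" "Suc t \<le> horizon m"
  shows "critical_fractile m t f \<le> critical_fractile m (Suc t) (extend_history t f z)"
  using fractile_le[OF assms(2), of t "Suc t"] assms
  by (simp add: truncate_extend_history truncate_realization)

text \<open>
  The backward induction hypothesis. The left side is the FIFO optimum, while on the right issuing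
  and ordering are arbitrary. The excess \<open>\<psi>\<close> of \<open>x\<close> over \<open>x'\<close> in stock above any given age bounds
  the additional units that can ever become outdated, hence the penalty.
\<close>

definition dominates_at :: "'b issuing \<Rightarrow> (nat \<Rightarrow> stock \<Rightarrow> 'b history \<Rightarrow> real) \<Rightarrow> nat \<Rightarrow> bool" where
  "dominates_at v \<pi> t \<longleftrightarrow> (\<forall>f\<in>realizations m t. \<forall>x\<in>stocks m. \<forall>x'\<in>stocks m. \<forall>q' \<psi>.
     (t \<le> horizon m \<longrightarrow> 0 \<le> q' \<and> ereal (aged m x 1) \<le> critical_fractile m t f) \<longrightarrow>
     0 \<le> \<psi> \<longrightarrow> (\<forall>k\<ge>1. aged m x k \<le> aged m x' k + \<psi>) \<longrightarrow>
     cost_to_go m t x f \<le> total_cost m v \<pi> t x' f q' + ennreal (outdating_cost m * \<psi>))"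

lemma dominates_atD:
  assumes "dominates_at v \<pi> t" "f \<in> realizations m t" "x \<in> stocks m" "x' \<in> stocks m"
    and "t \<le> horizon m \<Longrightarrow> 0 \<le> q'"
    and "t \<le> horizon m \<Longrightarrow> ereal (aged m x 1) \<le> critical_fractile m t f"
    and "0 \<le> \<psi>" "\<And>k. 1 \<le> k \<Longrightarrow> aged m x k \<le> aged m x' k + \<psi>"
  shows "cost_to_go m t x f \<le> total_cost m v \<pi> t x' f q' + ennreal (outdating_cost m * \<psi>)"
  using assms unfolding dominates_at_def by simp

text \<open>The one-period comparison for a given order \<open>q\<close>. The induction step
  supplies \<open>q\<close> from \<open>order_up_to_level\<close>; the final result takes the same
  state and order on both sides with \<open>\<psi> = 0\<close>.\<close>

lemma bellman_le_total_cost: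
  assumes t: "t \<in> {1..horizon m}" "f \<in> realizations m t"
    and x: "x \<in> stocks m" "0 \<le> q" and x': "x' \<in> stocks m" "0 \<le> q'"
    and v: "issuing_policy m {t} v"
    and \<pi>: "\<And>x f. Suc t \<le> horizon m \<Longrightarrow> x \<in> stocks m \<Longrightarrow> f \<in> realizations m (Suc t) \<Longrightarrow> 0 \<le> \<pi> (Suc t) x f"
    and \<psi>: "0 \<le> \<psi>" "\<And>k. aged m (x(0 := q)) k \<le> aged m (x'(0 := q')) k + \<psi>"
    and fractile: "ereal (on_hand m x q) \<le> critical_fractile m t f"
    and loss: "expected_loss m t f (on_hand m x q) \<le> expected_loss m t f (on_hand m x' q')"
    and IH: "dominates_at v \<pi> (Suc t)"
  shows "bellman m t (cost_to_go m (Suc t)) x f q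
    \<le> total_cost m v \<pi> t x' f q' + ennreal (outdating_cost m * \<psi>)"
proof -
  let ?w = "outdating_cost m" and ?\<beta> = "discount m" and ?K = "lifetime m" and ?M = "cond_law m t f"
  interpret prob_space ?M
    by (rule prob_space_cond_law[OF t])
  have issue: "\<And>k. k < ?K \<Longrightarrow> 0 \<le> v t x' f q' d k \<and> v t x' f q' d k \<le> (x'(0 := q')) k"
    "(\<Sum>k<?K. v t x' f q' d k) = min (on_hand m x' q') d" if "0 \<le> d" for d
    using v x' t(2) that unfolding issuing_policy_def by (simp_all del: fun_upd_apply)
  let ?g = "\<lambda>z. ennreal (?w * pos ((x(0 := q)) (?K - 1) - fst z)) +
    ennreal ?\<beta> * cost_to_go m (Suc t) (fifo_next m x q (fst z)) (extend_history t f z)"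
  let ?g' = "\<lambda>z. (let u = v t x' f q' (fst z); y = issue_next m x' q' u; f' = extend_history t f z
    in ennreal (?w * ((x'(0 := q')) (?K - 1) - u (?K - 1))) +
      ennreal ?\<beta> * total_cost m v \<pi> (Suc t) y f' (\<pi> (Suc t) y f'))"
  have "AE z in ?M. ?g z \<le> ennreal (?w * \<psi>) + ?g' z"
    using AE_extend_history[OF t]
  proof eventually_elim
    case (elim z)
    define d where "d = fst z"
    define u where "u = v t x' f q' d"
    define X where "X = fifo_next m x q d"
    define X' where "X' = issue_next m x' q' u"
    define f' where "f' = extend_history t f z"
    define out where "out = pos ((x(0 := q)) (?K - 1) - d)"
    define out' where "out' = (x'(0 := q')) (?K - 1) - u (?K - 1)"
    \<comment> \<open>Each side loses what outdates there, which changes the excess by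
      \<open>out' - out\<close>.\<close>
    define \<psi>' where "\<psi>' = max 0 (\<psi> + out' - out)"
    define J where "J = total_cost m v \<pi> (Suc t) X' f' (\<pi> (Suc t) X' f')"
    have d: "0 \<le> d" and f': "f' \<in> realizations m (Suc t)"
      using elim by (auto simp: d_def f'_def)
    note u = issue[OF d, folded u_def]
    have X: "X \<in> stocks m"
      by (simp add: X_def fifo_next_stocks)
    have X': "X' \<in> stocks m"
      unfolding X'_def using u(1) by (intro issue_next_stocks) blast
    \<comment> \<open>Index 0 is included: after aging it governs the stock of age at least
      1.\<close>
    have rest: "pos (aged m (x(0 := q)) k - d) \<le> aged m (\<lambda>j. (x'(0 := q')) j - u j) k + \<psi>" for k
      using \<psi>(1) \<psi>(2)[of k] aged_after_issuing[OF x' u, of k] by (simp add: pos_def)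
    have "out' = aged m (\<lambda>j. (x'(0 := q')) j - u j) (?K - 1)"
      using lifetime_pos aged_Suc[of "?K - 1" m "\<lambda>j. (x'(0 := q')) j - u j"] by (simp add: out'_def aged_beyond)
    moreover have out_eq: "out = pos (aged m (x(0 := q)) (?K - 1) - d)"
      unfolding out_def oldest_eq_aged ..
    ultimately have out: "out \<le> out' + \<psi>" "0 \<le> out"
      using rest[of "?K - 1"] by (simp_all add: out_def)
    have out'_nonneg: "0 \<le> out'"
      using u(1)[of "?K - 1"] lifetime_pos by (simp add: out'_def del: fun_upd_apply)
    have aged: "aged m X k \<le> aged m X' k + \<psi>'" if "1 \<le> k" for k
    proof (cases "k \<le> ?K")
      case True
      have "aged m X k = pos (aged m (x(0 := q)) (k - 1) - d) - out"
        using that True x by (simp add: X_def aged_fifo_next out_eq)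
      moreover have "aged m X' k = aged m (\<lambda>j. (x'(0 := q')) j - u j) (k - 1) - out'"
        unfolding X'_def out'_def using that True by (rule aged_issue_next)
      ultimately show ?thesis
        using rest[of "k - 1"] by (simp add: \<psi>'_def)
    qed (simp add: aged_beyond \<psi>'_def)
    have "cost_to_go m (Suc t) X f' \<le> J + ennreal (?w * \<psi>')"
    proof -
      \<comment> \<open>Demand and outdating only reduce the stock on hand, so it stays at or below
        the fractile of period \<open>t\<close>, which is at most the next one.\<close>
      have "ereal (aged m X 1) \<le> critical_fractile m (Suc t) f'" if "Suc t \<le> horizon m"
      proof -
        have "0 \<le> on_hand m x q"
          using aged_nonneg[OF x(1), of 1] x(2) by (simp add: on_hand_eq)
        then have "aged m X 1 \<le> on_hand m x q"
          using aged_fifo_next[OF x, of 1 d] lifetime_pos d out(2)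
          by (simp add: X_def out_eq on_hand_eq_aged pos_def del: fun_upd_apply)
        then have "ereal (aged m X 1) \<le> critical_fractile m t f"
          using fractile by (simp add: order_trans[OF _ fractile])
        also have "\<dots> \<le> critical_fractile m (Suc t) f'"
          using t f' that unfolding f'_def by (intro fractile_extend_le) auto
        finally show ?thesis .
      qed
      then show ?thesis
        unfolding J_def by (intro dominates_atD[OF IH f' X X' \<pi>[OF _ X' f']] aged) (auto simp: \<psi>'_def)
    qed
    then have "ennreal (?w * out) + ennreal ?\<beta> * cost_to_go m (Suc t) X f'
        \<le> ennreal (?w * out) + ennreal ?\<beta> * (J + ennreal (?w * \<psi>'))"
      by (intro add_left_mono mult_left_mono) auto
    also have "\<dots> = ennreal (?w * out + ?\<beta> * (?w * \<psi>')) + ennreal ?\<beta> * J"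
      using unit_costs discount out(2)
      by (simp add: \<psi>'_def ennreal_plus ennreal_mult distrib_left ac_simps)
    also have "\<dots> \<le> ennreal (?w * \<psi> + ?w * out') + ennreal ?\<beta> * J"
    proof (intro add_right_mono ennreal_leI)
      \<comment> \<open>Discounting can only shrink the new penalty; what remains is
        \<open>out + \<psi>' = \<psi> + out'\<close>, by the choice of \<open>\<psi>'\<close> and
        \<open>out \<le> out' + \<psi>\<close>.\<close>
      have "?\<beta> * \<psi>' \<le> \<psi>'"
        using discount by (simp add: \<psi>'_def mult_left_le_one_le)
      then have "out + ?\<beta> * \<psi>' \<le> \<psi> + out'"
        using out by (simp add: \<psi>'_def)
      from mult_left_mono[OF this unit_costs(3)]
      show "?w * out + ?\<beta> * (?w * \<psi>') \<le> ?w * \<psi> + ?w * out'"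
        by (simp add: algebra_simps)
    qed
    also have "\<dots> = ennreal (?w * \<psi>) + (ennreal (?w * out') + ennreal ?\<beta> * J)"
      using unit_costs \<psi>(1) out'_nonneg by (simp add: ennreal_plus add.assoc)
    finally show ?case
      unfolding Let_def X_def X'_def J_def f'_def out_def out'_def u_def d_def .
  qed
  then have "integral\<^sup>N ?M ?g \<le> (\<integral>\<^sup>+z. ennreal (?w * \<psi>) + ?g' z \<partial>?M)"
    by (rule nn_integral_mono_AE)
  also have "\<dots> = ennreal (?w * \<psi>) + integral\<^sup>N ?M ?g'"
    using nn_integral_add_measurable_left[of "\<lambda>_. ?w * \<psi>" ?M ?g'] by (simp only: nn_integral_const emeasure_space_1) simp
  finally have "bellman m t (cost_to_go m (Suc t)) x f q
      \<le> expected_loss m t f (on_hand m x' q') + (ennreal (?w * \<psi>) + integral\<^sup>N ?M ?g')"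
    unfolding bellman_eq[OF t] using loss by (rule add_mono[rotated])
  also have "\<dots> = expected_loss m t f (on_hand m x' q') + integral\<^sup>N ?M ?g' + ennreal (?w * \<psi>)"
    by (simp only: ac_simps)
  also have "expected_loss m t f (on_hand m x' q') + integral\<^sup>N ?M ?g' = total_cost m v \<pi> t x' f q'"
    using issue(1)[of _ "?K - 1"] lifetime_pos by (intro total_cost_eq[OF t x', symmetric]) simp
  finally show ?thesis .
qed

lemma dominates_at_step:
  assumes t: "t \<in> {1..horizon m}"
    and v: "issuing_policy m {t} v"
    and \<pi>: "\<And>x f. Suc t \<le> horizon m \<Longrightarrow> x \<in> stocks m \<Longrightarrow> f \<in> realizations m (Suc t) \<Longrightarrow> 0 \<le> \<pi> (Suc t) x f"
    and IH: "dominates_at v \<pi> (Suc t)"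
  shows "dominates_at v \<pi> t"
  unfolding dominates_at_def
proof (intro ballI allI impI)
  fix f x x' and q' \<psi> :: real
  assume f: "f \<in> realizations m t" and x: "x \<in> stocks m" and x': "x' \<in> stocks m"
    and "t \<le> horizon m \<longrightarrow> 0 \<le> q' \<and> ereal (aged m x 1) \<le> critical_fractile m t f"
    and \<psi>: "0 \<le> \<psi>" and aged: "\<forall>k\<ge>1. aged m x k \<le> aged m x' k + \<psi>"
  with t have q': "0 \<le> q'" and fractile: "ereal (aged m x 1) \<le> critical_fractile m t f"
    by auto
  from order_up_to_level[OF t f fractile, of "on_hand m x' q'"] obtain y
    where y: "aged m x 1 \<le> y" "y = aged m x 1 \<or> y \<le> on_hand m x' q'"
      "ereal y \<le> critical_fractile m t f"
      "expected_loss m t f y \<le> expected_loss m t f (on_hand m x' q')"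
    by blast
  define q where "q = y - aged m x 1"
  have q: "0 \<le> q" and on_hand: "on_hand m x q = y"
    using y by (auto simp: q_def on_hand_eq)
  \<comment> \<open>For \<open>1 \<le> k\<close> the order does not count. For \<open>k = 0\<close>,
    either nothing is ordered from \<open>x\<close>, or its level does not exceed the one reached
    from \<open>x'\<close>.\<close>
  have "aged m (x(0 := q)) k \<le> aged m (x'(0 := q')) k + \<psi>" for k
  proof (cases "1 \<le> k")
    case True
    then show ?thesis
      using aged by (simp add: aged_upd)
  next
    case False
    have "aged m x 1 \<le> aged m x' 1 + \<psi>"
      using aged by simp
    then have "y \<le> on_hand m x' q' + \<psi>"
      using y(2) \<psi> q' by (auto simp: on_hand_eq)
    then show ?thesis
      using False on_hand by (simp add: on_hand_eq_aged not_le)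
  qed
  then have "bellman m t (cost_to_go m (Suc t)) x f q
      \<le> total_cost m v \<pi> t x' f q' + ennreal (outdating_cost m * \<psi>)"
    using \<pi> \<psi> y(3,4) IH unfolding on_hand[symmetric]
    by (intro bellman_le_total_cost[OF t f x q x' q' v])
  moreover have "cost_to_go m t x f \<le> bellman m t (cost_to_go m (Suc t)) x f q"
    using t q by (intro cost_to_go_le_bellman) auto
  ultimately show "cost_to_go m t x f \<le> total_cost m v \<pi> t x' f q' + ennreal (outdating_cost m * \<psi>)"
    by (rule order_trans[rotated])
qed

lemma dominates_at_all:
  assumes v: "issuing_policy m {s..horizon m} v" and \<pi>: "optimal_ordering_policy m {s<..horizon m} \<pi>"
    and "1 \<le> s" "s \<le> t" "t \<le> Suc (horizon m)"
  shows "dominates_at v \<pi> t"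
  using assms(5,4)
proof (induction t rule: inc_induct)
  case base
  show ?case
    by (simp add: dominates_at_def cost_to_go_beyond_horizon)
next
  case (step t)
  show ?case
  proof (rule dominates_at_step)
    show "t \<in> {1..horizon m}"
      using step.hyps step.prems \<open>1 \<le> s\<close> by simp
    show "issuing_policy m {t} v"
      using v step.hyps step.prems by (simp add: issuing_policy_def)
    show "0 \<le> \<pi> (Suc t) x f"
      if "Suc t \<le> horizon m" "x \<in> stocks m" "f \<in> realizations m (Suc t)" for x f
      using \<pi> that step.prems by (simp add: optimal_ordering_policy_def optimal_order_def)
    show "dominates_at v \<pi> (Suc t)"
      using step.prems by (intro step.IH) simp
  qed
qed

section \<open>Optimality of FIFO\<close>

lemma fifo_minimizes_total_cost:
  assumes t: "t \<in> {1..horizon m}" "f \<in> realizations m t" and x: "x \<in> stocks m" "0 \<le> q"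
    and fractile: "ereal (on_hand m x q) \<le> critical_fractile m t f"
    and \<pi>: "optimal_ordering_policy m {t<..horizon m} \<pi>"
    and v: "issuing_policy m {t..horizon m} v"
  shows "total_cost m (fifo m) \<pi> t x f q \<le> total_cost m v \<pi> t x f q"
proof -
  have "total_cost m (fifo m) \<pi> t x f q \<le> bellman m t (cost_to_go m (Suc t)) x f q"
    using t x \<pi> by (intro total_cost_fifo_le_bellman) auto
  also have "\<dots> \<le> total_cost m v \<pi> t x f q + ennreal (outdating_cost m * 0)"
  proof (rule bellman_le_total_cost[OF t x x])
    show "issuing_policy m {t} v"
      using v t by (simp add: issuing_policy_def)
    show "0 \<le> \<pi> (Suc t) x f" if "Suc t \<le> horizon m" "x \<in> stocks m" "f \<in> realizations m (Suc t)" for x f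
      using \<pi> that by (simp add: optimal_ordering_policy_def optimal_order_def)
    show "dominates_at v \<pi> (Suc t)"
      using t by (intro dominates_at_all[OF v \<pi>]) auto
  qed (auto simp: fractile)
  finally show ?thesis
    by simp
qed

text \<open>Fractiles do not decrease along a realization, so the current period governs the maximum
  in the FIFO-optimality assumption.\<close>

lemma Max_fractile_le:
  assumes "t \<in> {1..horizon m}" "f \<in> realizations m t"
  shows "Max ((\<lambda>\<tau>. critical_fractile m \<tau> (truncate_history \<tau> f)) ` {1..t}) \<le> critical_fractile m t f"
proof -
  have "critical_fractile m \<tau> (truncate_history \<tau> f) \<le> critical_fractile m t f" if "\<tau> \<in> {1..t}" for \<tau>
    using fractile_le[OF assms(2), of \<tau> t] assms that by (simp add: truncate_realization)
  then show ?thesis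
    using assms by (intro Max.boundedI) auto
qed

end

theorem proposition3:
  fixes m :: "('w, 'u) perishable"
  assumes "perishable_inventory m"
    and "\<And>f. f \<in> realizations m (Suc (horizon m)) \<Longrightarrow>
           mono_on {1..horizon m} (\<lambda>t. critical_fractile m t (truncate_history t f))"
  shows "fifo_optimality m"
proof -
  interpret nondecreasing_fractiles m
    using assms by (simp add: nondecreasing_fractiles_def nondecreasing_fractiles_axioms_def)
  show ?thesis
    unfolding fifo_optimality_def
  proof (intro ballI allI impI)
    fix t f x q \<pi> v
    assume t: "t \<in> {1..horizon m}" "f \<in> realizations m t" and x: "x \<in> stocks m" "0 \<le> q"
      and "ereal (on_hand m x q)
        \<le> Max ((\<lambda>\<tau>. critical_fractile m \<tau> (truncate_history \<tau> f)) ` {1..t})"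
      and \<pi>: "optimal_ordering_policy m {t<..horizon m} \<pi>" and v: "issuing_policy m {t..horizon m} v"
    from this(5) Max_fractile_le[OF t] have "ereal (on_hand m x q) \<le> critical_fractile m t f"
      by (rule order_trans)
    with t x show "total_cost m (fifo m) \<pi> t x f q \<le> total_cost m v \<pi> t x f q"
      using \<pi> v by (rule fifo_minimizes_total_cost)
  qed
qed

end
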